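(* There are no infinite, finitely constrained, topologically finitely generated groups of binary tree automorphisms defined by forbidden patterns of size at most $2$. That is, let $X=\{0,1\}$ and let $\mathcal F$ be any set of patterns on $X^*$, each of size $1$ or $2$, such that the set $\mathcal G(\mathcal F)$ of all $g\in \mathrm{Aut}(X^* )$ that contain no pattern from $\mathcal F$ at any vertex is a subgroup of $\mathrm{Aut}(X^* )$. If $\mathcal G(\mathcal F)$ is infinite, then $\mathcal G(\mathcal F)$ is not topologically finitely generated.
   Context: Let $X=\{0,1\}$. $X^*$ denotes both the set of finite words over $X$ and the binary rooted tree whose vertices are these words, with root the empty word $\emptyset$ and each vertex $u$ joined to its children $u0,u1$. $\mathrm{Aut}(X^* )$ is the group of rooted tree automorphisms, with product $(fg)(u)=f(g(u))$. For $g \in \mathrm{Aut}(X^* )$ and a vertex $u$, $g_{(u)}\in \mathrm{Sym}(X)$ is the permutation defined by $g(ux)=g(u)\,g_{(u)}(x)$ for $x \in X$. The map $u\mapsto g_{(u)}$ is the portrait of $g$; every map $X^*\to \mathrm{Sym}(X)$ is the portrait of a unique automorphism. Topology: $\mathrm{Aut}(X^* )$ carries the metric $d(g,h)=\sup\{2^{-|u|} \mid u\in X^*,\ g_{(u)}\ne h_{(u)}\}$ for $g \neq h$ (equivalently, the product topology on $\mathrm{Sym}(X)^{X^*}$ with $\mathrm{Sym}(X)$ discrete). Patterns: a pattern of size $m\ge 1$ is a map $p:\bigcup_{i=0}^{m-1}X^i\to \mathrm{Sym}(X)$, $v\mapsto p_{(v)}$. An automorphism $g$ contains $p$ at the vertex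 $u$ if $g_{(uv)}=p_{(v)}$ for all words $v$ with $|v|\le m-1$. A finitely constrained group is a subgroup of $\mathrm{Aut}(X^* )$ of the form $\mathcal G(\mathcal F)$ for a finite set $\mathcal F$ of (forbidden) patterns; such a group is closed in $\mathrm{Aut}(X^* )$. (There are only finitely many patterns of size at most $2$.) A closed subgroup $G\le\mathrm{Aut}(X^* )$ is topologically finitely generated if it is the topological closure of the group generated by some finite set. *)

theory Defs
  imports "HOL-Analysis.Analysis" "HOL-Algebra.Generated_Groups"
begin

section \<open>Automorphisms of the binary rooted tree\<close>

text \<open>The alphabet is \<^typ>\<open>bool\<close>. The children of the word \<open>u\<close> are \<open>u @ [x]\<close>, so the root is on
  the left of a word.\<close>

type_synonym word = "bool list"

definition adjacent :: "word \<Rightarrow> word \<Rightarrow> bool" where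
  "adjacent u v \<longleftrightarrow> (\<exists>x. v = u @ [x]) \<or> (\<exists>x. u = v @ [x])"

definition tree_automorphism :: "(word \<Rightarrow> word) \<Rightarrow> bool" where
  "tree_automorphism g \<longleftrightarrow> bij g \<and> g [] = [] \<and> (\<forall>u v. adjacent (g u) (g v) \<longleftrightarrow> adjacent u v)"

definition AutT :: "(word \<Rightarrow> word) monoid" where
  "AutT = \<lparr>carrier = {g. tree_automorphism g}, mult = (\<lambda>f g. f \<circ> g), one = id\<rparr>"

text \<open>Since \<open>g (u @ [x]) = g u @ [g_u x]\<close> for an automorphism \<open>g\<close>, the permutation \<open>g_u\<close> is read
  off the last letter; see \<open>automorphism_append\<close> and \<open>bij_local_perm\<close> below.\<close>

definition local_perm :: "(word \<Rightarrow> word) \<Rightarrow> word \<Rightarrow> bool \<Rightarrow> bool" where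
  "local_perm g u x = last (g (u @ [x]))"

text \<open>An automorphism is determined by its portrait (\<open>automorphism_eqI\<close>), so on automorphisms the
  test in the next definition is \<open>g = h\<close>. Comparing portraits instead makes the function
  nonnegative on all pairs of functions, as \<^locale>\<open>Metric_space\<close> requires.\<close>

definition aut_dist :: "(word \<Rightarrow> word) \<Rightarrow> (word \<Rightarrow> word) \<Rightarrow> real" where
  "aut_dist g h =
    (if local_perm g = local_perm h then 0
     else Sup {(1/2) ^ length u |u. local_perm g u \<noteq> local_perm h u})"

definition aut_topology :: "(word \<Rightarrow> word) topology" where
  "aut_topology = Metric_space.mtopology (carrier AutT) aut_dist"

definition topologically_finitely_generated :: "(word \<Rightarrow> word) set \<Rightarrow> bool" where
  "topologically_finitely_generated G \<longleftrightarrow>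
    (\<exists>S. finite S \<and> S \<subseteq> carrier AutT \<and> G = aut_topology closure_of (generate AutT S))"


section \<open>Patterns\<close>

text \<open>A pattern is stored together with its size, and its map is \<open>undefined\<close> outside its domain.\<close>

type_synonym pattern = "nat \<times> (word \<Rightarrow> bool \<Rightarrow> bool)"

definition patterns :: "nat \<Rightarrow> pattern set" where
  "patterns m = {m} \<times> ({v. length v < m} \<rightarrow>\<^sub>E {s. bij s})"

definition contains_at :: "(word \<Rightarrow> word) \<Rightarrow> pattern \<Rightarrow> word \<Rightarrow> bool" where
  "contains_at g p u \<longleftrightarrow> (\<forall>v. length v < fst p \<longrightarrow> local_perm g (u @ v) = snd p v)"

definition avoiding :: "pattern set \<Rightarrow> (word \<Rightarrow> word) set" where
  "avoiding F = {g \<in> carrier AutT. \<forall>p\<in>F. \<forall>u. \<not> contains_at g p u}"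


section \<open>Basic facts\<close>

lemma automorphism_Nil: "tree_automorphism g \<Longrightarrow> g [] = []"
  by (simp add: tree_automorphism_def)

lemma automorphism_append_ex:
  assumes g: "tree_automorphism g"
  shows "\<exists>y. g (u @ [x]) = g u @ [y]"
proof (induction u arbitrary: x rule: rev_induct)
  case Nil
  have "adjacent [] [x]"
    by (simp add: adjacent_def)
  then have "adjacent (g []) (g [x])"
    using g unfolding tree_automorphism_def by blast
  then show ?case
    by (auto simp: adjacent_def automorphism_Nil[OF g])
next
  case (snoc z u)
  obtain y where y: "g (u @ [z]) = g u @ [y]"
    using snoc by blast
  have "adjacent (u @ [z]) (u @ [z] @ [x])"
    by (simp add: adjacent_def)
  then have "adjacent (g (u @ [z])) (g (u @ [z] @ [x]))"
    using g unfolding tree_automorphism_def by blast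
  moreover have "g (u @ [z] @ [x]) \<noteq> g u"
    using g by (auto simp: tree_automorphism_def bij_def inj_eq)
  ultimately show ?case
    by (auto simp: adjacent_def y)
qed

lemma automorphism_append:
  assumes "tree_automorphism g"
  shows "g (u @ [x]) = g u @ [local_perm g u x]"
  using automorphism_append_ex[OF assms, of u x] by (auto simp: local_perm_def)

lemma bij_local_perm:
  assumes g: "tree_automorphism g"
  shows "bij (local_perm g u)"
proof -
  have "inj (local_perm g u)"
  proof (rule injI)
    fix x y assume "local_perm g u x = local_perm g u y"
    then have "g (u @ [x]) = g (u @ [y])"
      by (simp add: automorphism_append[OF g])
    then show "x = y"
      using g by (auto simp: tree_automorphism_def bij_def inj_eq)
  qed
  then show ?thesis
    by (simp add: bij_def finite_UNIV_inj_surj)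
qed

lemma automorphism_eqI:
  assumes g: "tree_automorphism g" and h: "tree_automorphism h"
    and eq: "local_perm g = local_perm h"
  shows "g = h"
proof
  fix u show "g u = h u"
    by (induction u rule: rev_induct)
      (simp_all add: automorphism_append[OF g] automorphism_append[OF h]
        automorphism_Nil[OF g] automorphism_Nil[OF h] eq)
qed

lemma portrait_realized:
  assumes "\<And>u. bij (p u)"
  shows "\<exists>!g. tree_automorphism g \<and> local_perm g = p"
proof -
  define g where "g u = map (\<lambda>i. p (take i u) (u ! i)) [0..<length u]" for u
  have g_Nil: "g [] = []" by (simp add: g_def)
  have g_app: "g (u @ [x]) = g u @ [p u x]" for u x
    by (auto simp: g_def nth_append)
  have len: "length (g u) = length u" for u by (simp add: g_def)
  have p_inj: "p u x = p u y \<longleftrightarrow> x = y" for u x y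
    using assms[of u] by (simp add: bij_def inj_eq)
  have eq: "g u = g v \<longleftrightarrow> u = v" for u v
  proof (induction u arbitrary: v rule: rev_induct)
    case Nil
    then show ?case using len[of v] by (auto simp: g_Nil)
  next
    case (snoc x u)
    show ?case
    proof (cases v rule: rev_cases)
      case Nil
      then show ?thesis by (simp add: g_app g_Nil)
    next
      case (snoc w y)
      then have "g (u @ [x]) = g v \<longleftrightarrow> u = w \<and> p u x = p w y"
        using snoc.IH[of w] by (simp add: g_app)
      then show ?thesis using p_inj[of w x y] snoc by fastforce
    qed
  qed
  have "\<exists>u. g u = w" for w
  proof (induction w rule: rev_induct)
    case Nil
    then show ?case using g_Nil by blast
  next
    case (snoc y w)
    then obtain u where "g u = w" by blast
    moreover obtain x where "p u x = y"
      using assms[of u] by (metis bij_pointE)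
    ultimately show ?case using g_app by blast
  qed
  then have "bij g"
    using eq by (metis bijI injI surjI surj_def)
  moreover have child: "(\<exists>y. g v = g u @ [y]) \<longleftrightarrow> (\<exists>x. v = u @ [x])" for u v
  proof
    assume "\<exists>y. g v = g u @ [y]"
    then obtain y where y: "g v = g u @ [y]" by blast
    then obtain w x where v: "v = w @ [x]"
      by (cases v rule: rev_cases) (auto simp: g_Nil)
    then show "\<exists>x. v = u @ [x]"
      using y eq by (auto simp: g_app)
  qed (auto simp: g_app)
  ultimately have "tree_automorphism g"
    by (simp add: tree_automorphism_def adjacent_def g_Nil)
  moreover have "local_perm g = p"
    by (simp add: local_perm_def fun_eq_iff g_app)
  ultimately show ?thesis
    using automorphism_eqI by blast
qed

lemma group_AutT: "group AutT"
proof (rule groupI)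
  fix g assume "g \<in> carrier AutT"
  then have g: "tree_automorphism g" by (simp add: AutT_def)
  then have b: "bij g" by (simp add: tree_automorphism_def)
  have s: "g (inv_into UNIV g u) = u" for u
    using b by (simp add: bij_def surj_f_inv_f)
  have "adjacent (inv_into UNIV g u) (inv_into UNIV g v) \<longleftrightarrow> adjacent u v" for u v
    using g s[of u] s[of v] unfolding tree_automorphism_def by metis
  moreover have "inv_into UNIV g [] = []"
    using b automorphism_Nil[OF g] by (metis bij_inv_eq_iff)
  ultimately have "tree_automorphism (inv_into UNIV g)"
    using b by (simp add: tree_automorphism_def bij_imp_bij_inv)
  moreover have "inv_into UNIV g \<circ> g = id"
    using b by (simp add: bij_def)
  ultimately show "\<exists>h\<in>carrier AutT. h \<otimes>\<^bsub>AutT\<^esub> g = \<one>\<^bsub>AutT\<^esub>"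
    by (auto simp: AutT_def)
qed (auto simp: AutT_def tree_automorphism_def comp_assoc bij_comp)

lemma aut_dist_bdd: "bdd_above {(1/2::real) ^ length u |u. P u}"
  by (rule bdd_aboveI[of _ 1]) (auto simp: power_le_one)

lemma aut_dist_ge:
  "local_perm g u \<noteq> local_perm h u \<Longrightarrow> (1/2) ^ length u \<le> aut_dist g h"
  by (auto simp: aut_dist_def intro!: cSup_upper aut_dist_bdd)

lemma aut_dist_le:
  assumes "\<And>u. local_perm g u \<noteq> local_perm h u \<Longrightarrow> (1/2) ^ length u \<le> c" "0 \<le> c"
  shows "aut_dist g h \<le> c"
  using assms by (auto simp: aut_dist_def fun_eq_iff intro!: cSup_least)

lemma aut_dist_nonneg: "0 \<le> aut_dist g h"
proof (cases "local_perm g = local_perm h")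
  case False
  then obtain u where "local_perm g u \<noteq> local_perm h u" by blast
  from aut_dist_ge[OF this] show ?thesis
    by (meson order_trans zero_le_divide_1_iff zero_le_numeral zero_le_power)
qed (simp add: aut_dist_def)

lemma Metric_space_AutT: "Metric_space (carrier AutT) aut_dist"
proof
  fix g h :: "word \<Rightarrow> word"
  show "0 \<le> aut_dist g h" by (rule aut_dist_nonneg)
  show "aut_dist g h = aut_dist h g"
    by (auto simp: aut_dist_def eq_commute)
next
  fix g h assume "g \<in> carrier AutT" "h \<in> carrier AutT"
  then have gh: "tree_automorphism g" "tree_automorphism h" by (simp_all add: AutT_def)
  show "aut_dist g h = 0 \<longleftrightarrow> g = h"
  proof
    assume d: "aut_dist g h = 0"
    have "local_perm g u = local_perm h u" for u
      using aut_dist_ge[of g u h] by (auto simp: d not_le power_le_zero_eq)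
    then show "g = h"
      using automorphism_eqI[OF gh] by blast
  qed (simp add: aut_dist_def)
next
  fix f g h
  show "aut_dist f h \<le> aut_dist f g + aut_dist g h"
  proof (rule aut_dist_le)
    fix u assume "local_perm f u \<noteq> local_perm h u"
    then have "local_perm f u \<noteq> local_perm g u \<or> local_perm g u \<noteq> local_perm h u"
      by auto
    then show "(1/2) ^ length u \<le> aut_dist f g + aut_dist g h"
      using aut_dist_ge[of f u g] aut_dist_ge[of g u h] aut_dist_nonneg[of f g]
        aut_dist_nonneg[of g h] by linarith
  qed (simp add: aut_dist_nonneg)
qed

end

theory Submission
  imports Defs "HOL-Number_Theory.Cong"
begin

text \<open>
  The size 2 patterns occurring in \<open>G = avoiding F\<close> form a subgroup \<open>P\<close> of the dihedral group of
  order 8, and \<open>G\<close> consists of all automorphisms whose size 2 patterns lie in \<open>P\<close>.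
  If \<open>G\<close> is infinite, then \<open>P\<close> acts nontrivially on the first level and contains a nontrivial
  pattern with trivial root. This leaves the full group and two abelian groups of order 4, and each
  has a homomorphism \<open>\<phi>\<close> to the integers mod 4 that is nonzero on some pattern with trivial root.
  The pattern of \<open>f \<circ> g\<close> at \<open>u\<close> is the product of those of \<open>f\<close> at \<open>g u\<close> and of \<open>g\<close> at \<open>u\<close>, so summing
  \<open>\<phi>\<close> over level \<open>n\<close> gives a homomorphism \<open>\<Phi>\<^sub>n\<close> from \<open>G\<close> to the integers mod 4. A finitely generated
  subgroup takes only finitely many values under \<open>(\<Phi>\<^sub>n)\<^sub>n\<close>. On the other hand, \<open>G\<close> has for each \<open>n\<close> an
  element with \<open>\<Phi>\<^sub>m = 0\<close> for \<open>m < n\<close> and \<open>\<Phi>\<^sub>n \<noteq> 0\<close>, and so does every dense subgroup.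
\<close>

section \<open>Portraits with values in the Booleans\<close>

text \<open>A permutation of \<open>bool\<close> is determined by its value at \<open>False\<close>:
  \<open>True\<close> encodes the transposition, and composition becomes exclusive or.\<close>

definition swap :: "(word \<Rightarrow> word) \<Rightarrow> word \<Rightarrow> bool" where
  "swap g u = local_perm g u False"

lemma local_perm_swap:
  assumes "tree_automorphism g"
  shows "local_perm g u x = (x \<noteq> swap g u)"
proof (cases x)
  case True
  have "local_perm g u True \<noteq> local_perm g u False"
    using bij_local_perm[OF assms, of u] by (simp add: bij_def inj_eq)
  then show ?thesis
    using True by (simp add: swap_def)
qed (simp add: swap_def)

lemma local_perm_eq_iff_swap:
  assumes "tree_automorphism g" "tree_automorphism h"
  shows "local_perm g u = local_perm h v \<longleftrightarrow> swap g u = swap h v"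
  by (auto simp: fun_eq_iff local_perm_swap assms)

lemma automorphism_eq_swapI:
  assumes "tree_automorphism g" "tree_automorphism h" "\<And>u. swap g u = swap h u"
  shows "g = h"
  using assms by (auto intro!: automorphism_eqI simp: local_perm_eq_iff_swap)

lemma swap_realized: "\<exists>g. tree_automorphism g \<and> (\<forall>u. swap g u = s u)"
proof -
  have "bij (\<lambda>x. x \<noteq> s u)" for u
    by (rule o_bij[of "\<lambda>x. x \<noteq> s u"]) auto
  from portrait_realized[of "\<lambda>u x. x \<noteq> s u", OF this] show ?thesis
    by (auto simp: swap_def)
qed

lemma swap_comp:
  assumes f: "tree_automorphism f" and g: "tree_automorphism g"
  shows "swap (f \<circ> g) u = (swap f (g u) \<noteq> swap g u)"
proof -
  have "swap (f \<circ> g) u = local_perm f (g u) (local_perm g u False)"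
    by (simp add: swap_def local_perm_def[of "f \<circ> g"] automorphism_append[OF f]
        automorphism_append[OF g])
  then show ?thesis
    by (auto simp: local_perm_swap f g)
qed

lemma length_automorphism:
  assumes "tree_automorphism g"
  shows "length (g u) = length u"
  by (induction u rule: rev_induct)
    (simp_all add: automorphism_append[OF assms] automorphism_Nil[OF assms])

lemma bij_betw_level:
  assumes "tree_automorphism g"
  shows "bij_betw g {u. length u = n} {u. length u = n}"
proof -
  have b: "bij g"
    using assms by (simp add: tree_automorphism_def)
  have "\<exists>v. length v = n \<and> u = g v" if "length u = n" for u
    using bij_is_surj[OF b] length_automorphism[OF assms] that by (metis surj_def)
  then show ?thesis
    using b by (auto simp: bij_betw_def length_automorphism[OF assms] bij_def inj_on_def)
qed

lemma finite_level: "finite {u :: word. length u = n}"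
  using finite_lists_length_eq[of "UNIV :: bool set" n] by simp


section \<open>Patterns of size 2\<close>

type_synonym triple = "bool \<times> bool \<times> bool"

definition triple_at :: "(word \<Rightarrow> word) \<Rightarrow> word \<Rightarrow> triple" where
  "triple_at g u = (swap g u, swap g (u @ [False]), swap g (u @ [True]))"

text \<open>The dihedral group of order 8 as a wreath product of two groups of order 2. The right
  factor acts first, so its root label \<open>a'\<close> decides whether the child labels of the
  left factor change places.\<close>

fun triple_mult :: "triple \<Rightarrow> triple \<Rightarrow> triple" where
  "triple_mult (a, b, c) (a', b', c') =
    (a \<noteq> a', (if a' then c else b) \<noteq> b', (if a' then b else c) \<noteq> c')"

lemma triple_at_comp:
  assumes "tree_automorphism f" "tree_automorphism g"
  shows "triple_at (f \<circ> g) u = triple_mult (triple_at f (g u)) (triple_at g u)"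
  using assms
  by (auto simp: triple_at_def swap_comp automorphism_append[of g] local_perm_swap)

text \<open>Two patterns with root \<open>True\<close> multiply to one with trivial root, so the
  square of the first and its product with the second are both the identity.\<close>

lemma triple_unique_root:
  assumes mult: "\<And>s t. s \<in> P \<Longrightarrow> t \<in> P \<Longrightarrow> triple_mult s t \<in> P"
    and triv: "\<And>b c. (False, b, c) \<in> P \<Longrightarrow> \<not> b \<and> \<not> c"
    and "(a, b, c) \<in> P" "(a, b', c') \<in> P"
  shows "b = b' \<and> c = c'"
proof (cases a)
  case True
  have "(False, c \<noteq> b, b \<noteq> c) \<in> P" "(False, c \<noteq> b', b \<noteq> c') \<in> P"
    using mult[OF assms(3,3)] mult[OF assms(3,4)] True by simp_all
  from this[THEN triv] show ?thesis by blast
next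
  case False
  then have "(False, b, c) \<in> P" "(False, b', c') \<in> P"
    using assms(3,4) by simp_all
  from this[THEN triv] show ?thesis by blast
qed

text \<open>The modulus is 4 because \<open>P\<close> may be cyclic of order 4. Its nontrivial
  pattern with trivial root is then a square, which every homomorphism to the integers mod 2
  kills.\<close>

lemma triple_character:
  fixes P :: "triple set"
  assumes mult: "\<And>s t. s \<in> P \<Longrightarrow> t \<in> P \<Longrightarrow> triple_mult s t \<in> P"
    and "(True, p, q) \<in> P" "(False, b, c) \<in> P" "b \<or> c"
  shows "\<exists>\<phi> :: triple \<Rightarrow> int. \<phi> (False, False, False) = 0
    \<and> (\<forall>s\<in>P. \<forall>t\<in>P. [\<phi> (triple_mult s t) = \<phi> s + \<phi> t] (mod 4))
    \<and> (\<exists>b c. (False, b, c) \<in> P \<and> \<not> [\<phi> (False, b, c) = 0] (mod 4))"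
proof -
  have m: "(a \<noteq> a', (if a' then c else b) \<noteq> b', (if a' then b else c) \<noteq> c') \<in> P"
    if "(a, b, c) \<in> P" "(a', b', c') \<in> P" for a b c a' b' c'
    using mult[OF that] by simp
  have flip: "(False, c, b) \<in> P" if "(False, b, c) \<in> P" for b c
  proof -
    \<comment> \<open>With r = \<open>(True, p, q)\<close> and s = \<open>(False, b, c)\<close> this
      is r s r^3. Since r^4 = 1, it is the conjugate of s by r; the cube replaces the inverse, as
      only closure under products is given.\<close>
    have "triple_mult (triple_mult (triple_mult (True, p, q) (False, b, c)) (True, p, q)) 
        (triple_mult (True, p, q) (True, p, q)) \<in> P"
      using mult assms(2) that by blast
    then show ?thesis by (cases b; cases c; cases p; cases q) simp_all
  qed
  consider (full) "(False, True, False) \<in> P"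
    | (diag) "(False, True, False) \<notin> P" "(False, False, True) \<notin> P"
    using flip by blast
  then show ?thesis
  proof cases
    case full
    \<comment> \<open>Products permute child labels before adding them, so the parity of their
      number is a homomorphism; the factor 2 embeds it into the integers mod 4.\<close>
    define \<phi> :: "triple \<Rightarrow> int" where "\<phi> = (\<lambda>(a, b, c). 2 * of_bool b + 2 * of_bool c)"
    have "[\<phi> (triple_mult s t) = \<phi> s + \<phi> t] (mod 4)" for s t
    proof -
      obtain a b c a' b' c' where st: "s = (a, b, c)" "t = (a', b', c')"
        by (metis prod_cases3)
      show ?thesis
        unfolding st
        by (cases a'; cases b; cases c; cases b'; cases c') (simp_all add: \<phi>_def cong_def)
    qed
    moreover have "\<phi> (False, False, False) = 0" "\<not> [\<phi> (False, True, False) = 0] (mod 4)"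
      by (simp_all add: \<phi>_def cong_def)
    ultimately show ?thesis using full by blast
  next
    case diag
    then have TT: "(False, True, True) \<in> P"
      using assms(3,4) by (cases b; cases c) auto
    have K: "b = c" if "(False, b, c) \<in> P" for b c
      using that diag by (cases b; cases c) auto
    have coset: "(b = c) \<longleftrightarrow> (p = q)" if "(True, b, c) \<in> P" for b c
    proof -
      have "(False, c \<noteq> p, b \<noteq> q) \<in> P"
        using m[OF that assms(2)] by simp
      from K[OF this] show ?thesis by blast
    qed
    \<comment> \<open>If \<open>p = q\<close>, \<open>P\<close> is a Klein four-group and the second
      summand vanishes. If \<open>p \<noteq> q\<close>, the patterns with root \<open>True\<close>
      have order 4 and go to 1 and 3, their square \<open>(False, True, True)\<close> to 2.\<close>
    define \<phi> :: "triple \<Rightarrow> int" where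
      "\<phi> = (\<lambda>(a, b, c). 2 * of_bool b + of_bool (a \<and> p \<noteq> q))"
    have "[\<phi> (triple_mult s t) = \<phi> s + \<phi> t] (mod 4)" if "s \<in> P" "t \<in> P" for s t
    proof -
      obtain a b c a' b' c' where st: "s = (a, b, c)" "t = (a', b', c')"
        by (metis prod_cases3)
      have "if a then (b = c) = (p = q) else b = c"
        "if a' then (b' = c') = (p = q) else b' = c'"
        using that K[of b c] K[of b' c'] coset[of b c] coset[of b' c'] unfolding st
        by (cases a; cases a'; simp)+
      then show ?thesis
        unfolding st
        by (cases a; cases b; cases c; cases a'; cases b'; cases c')
          (simp_all add: \<phi>_def cong_def)
    qed
    moreover have "\<phi> (False, False, False) = 0" "\<not> [\<phi> (False, True, True) = 0] (mod 4)"
      by (simp_all add: \<phi>_def cong_def)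
    ultimately show ?thesis using TT by blast
  qed
qed


section \<open>Groups defined by patterns of size at most 2\<close>

lemma avoiding_automorphism: "g \<in> avoiding F \<Longrightarrow> tree_automorphism g"
  by (simp add: avoiding_def AutT_def)

text \<open>Forbidden patterns are tested at all vertices alike, so the section \<open>h\<close> of
  \<open>g\<close> at \<open>u\<close> avoids them too.\<close>

lemma avoiding_section:
  assumes "g \<in> avoiding F"
  shows "\<exists>h\<in>avoiding F. \<forall>v. swap h v = swap g (u @ v)"
proof -
  have g: "tree_automorphism g"
    using assms by (rule avoiding_automorphism)
  obtain h where h: "tree_automorphism h" "\<And>v. swap h v = swap g (u @ v)"
    using swap_realized[of "\<lambda>v. swap g (u @ v)"] by blast
  have "local_perm h v = local_perm g (u @ v)" for v
    by (simp add: local_perm_eq_iff_swap h g)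
  then have "contains_at h p v \<longleftrightarrow> contains_at g p (u @ v)" for p v
    by (simp add: contains_at_def)
  then have "h \<in> avoiding F"
    using assms h(1) by (simp add: avoiding_def AutT_def)
  then show ?thesis
    using h(2) by blast
qed

definition root_triples :: "(word \<Rightarrow> word) set \<Rightarrow> triple set" where
  "root_triples G = (\<lambda>g. triple_at g []) ` G"

lemma triple_at_avoiding:
  assumes "g \<in> avoiding F"
  shows "triple_at g u \<in> root_triples (avoiding F)"
proof -
  obtain h where h: "h \<in> avoiding F" "\<And>v. swap h v = swap g (u @ v)"
    using avoiding_section[OF assms] by blast
  have "triple_at g u = triple_at h []"
    by (simp add: triple_at_def h(2))
  then show ?thesis
    using h(1) unfolding root_triples_def by (rule image_eqI)
qed

text \<open>A pattern of size at most 2 sees only a vertex and its children. If \<open>g\<close>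
  contained a forbidden one, so would the member with the same triple at its root.\<close>

lemma avoiding_memberI:
  assumes F: "F \<subseteq> patterns 1 \<union> patterns 2" and g: "tree_automorphism g"
    and P: "\<And>u. triple_at g u \<in> root_triples (avoiding F)"
  shows "g \<in> avoiding F"
proof -
  have "\<not> contains_at g p u" if p: "p \<in> F" for p u
  proof
    assume c: "contains_at g p u"
    obtain h where h: "h \<in> avoiding F" "triple_at g u = triple_at h []"
      using P[of u] by (auto simp: root_triples_def)
    have size: "fst p \<le> 2"
      using F p by (auto simp: patterns_def)
    have eq: "local_perm g (u @ v) = local_perm h v" if "length v < fst p" for v
    proof -
      have "length v \<le> 1"
        using that size by simp
      then consider "v = []" | "v = [False]" | "v = [True]"
        by (cases v) auto
      then have "swap g (u @ v) = swap h v"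
        by cases (use h(2) in \<open>simp_all add: triple_at_def\<close>)
      then show ?thesis
        by (simp add: local_perm_eq_iff_swap[OF g avoiding_automorphism[OF h(1)]])
    qed
    have "contains_at h p []"
      using c eq by (simp add: contains_at_def)
    then show False
      using h(1) p by (simp add: avoiding_def)
  qed
  then show ?thesis
    using g by (simp add: avoiding_def AutT_def)
qed

lemma root_triples_mult:
  assumes "subgroup (avoiding F) AutT"
    and "s \<in> root_triples (avoiding F)" "t \<in> root_triples (avoiding F)"
  shows "triple_mult s t \<in> root_triples (avoiding F)"
proof -
  obtain f g where fg: "f \<in> avoiding F" "g \<in> avoiding F"
    "s = triple_at f []" "t = triple_at g []"
    using assms(2,3) by (auto simp: root_triples_def)
  have "f \<circ> g \<in> avoiding F"
    using subgroup.m_closed[OF assms(1) fg(1,2)] by (simp add: AutT_def)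
  moreover have "triple_at (f \<circ> g) [] = triple_mult s t"
    using fg by (simp add: triple_at_comp avoiding_automorphism automorphism_Nil)
  ultimately show ?thesis
    by (metis image_eqI root_triples_def)
qed

text \<open>If only the identity had trivial root, each label would determine those of its children,
  leaving at most one member per root label. Once a child label is nontrivial, the section at that
  child swaps the first level.\<close>

lemma infinite_avoiding_triples:
  assumes "subgroup (avoiding F) AutT" "infinite (avoiding F)"
  shows "\<exists>b c. (False, b, c) \<in> root_triples (avoiding F) \<and> (b \<or> c)"
    and "\<exists>p q. (True, p, q) \<in> root_triples (avoiding F)"
proof -
  show ex: "\<exists>b c. (False, b, c) \<in> root_triples (avoiding F) \<and> (b \<or> c)"
  proof (rule ccontr)
    assume "\<not> ?thesis"
    then have triv: "\<not> b \<and> \<not> c" if "(False, b, c) \<in> root_triples (avoiding F)" for b c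
      using that by blast
    have "inj_on (\<lambda>g. swap g []) (avoiding F)"
    proof (rule inj_onI)
      fix g h assume gh: "g \<in> avoiding F" "h \<in> avoiding F" and root: "swap g [] = swap h []"
      have "swap g u = swap h u" for u
      proof (induction u rule: rev_induct)
        case (snoc x u)
        have "swap g (u @ [False]) = swap h (u @ [False])
            \<and> swap g (u @ [True]) = swap h (u @ [True])"
          by (rule triple_unique_root[OF root_triples_mult[OF assms(1)] triv])
            (use triple_at_avoiding[OF gh(1), of u] triple_at_avoiding[OF gh(2), of u] snoc
              in \<open>auto simp: triple_at_def\<close>)
        then show ?case by (cases x) auto
      qed (rule root)
      then show "g = h"
        using gh automorphism_eq_swapI avoiding_automorphism by blast
    qed
    then show False
      using assms(2) finite_imageD finite by blast
  qed
  obtain g x where "g \<in> avoiding F" "swap g [x]"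
    using ex by (auto simp: root_triples_def triple_at_def)
  then show "\<exists>p q. (True, p, q) \<in> root_triples (avoiding F)"
    using triple_at_avoiding[of g F "[x]"] by (auto simp: triple_at_def)
qed

text \<open>The element acts below the vertex \<open>0\<^sup>n\<close> like an element of the group with pattern \<open>(False, b, c)\<close>
  at its root, and trivially elsewhere.\<close>

lemma avoiding_deep_element:
  assumes F: "F \<subseteq> patterns 1 \<union> patterns 2" and G: "subgroup (avoiding F) AutT"
    and "(False, b, c) \<in> root_triples (avoiding F)"
  shows "\<exists>g\<in>avoiding F. triple_at g (replicate n False) = (False, b, c) \<and>
    (\<forall>u. length u \<le> n \<longrightarrow> u \<noteq> replicate n False \<longrightarrow> triple_at g u = (False, False, False))"
proof -
  let ?z = "replicate n False"
  obtain k where k: "k \<in> avoiding F" "triple_at k [] = (False, b, c)"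
    using assms(3) by (auto simp: root_triples_def)
  obtain g where g: "tree_automorphism g"
    and s: "\<And>u. swap g u = (take n u = ?z \<and> swap k (drop n u))"
    using swap_realized[of "\<lambda>u. take n u = ?z \<and> swap k (drop n u)"] by blast
  have k0: "\<not> swap k []" and kb: "swap k [False] = b" "swap k [True] = c"
    using k(2) by (auto simp: triple_at_def)
  have below: "triple_at g u = triple_at k (drop n u)" if "take n u = ?z" for u
  proof -
    have "n \<le> length u"
      using arg_cong[OF that, of length] by simp
    then show ?thesis using that by (simp add: triple_at_def s)
  qed
  \<comment> \<open>The parent of \<open>?z\<close> sees the label at \<open>?z\<close>, which is
    \<open>swap k []\<close> and hence trivial.\<close>
  have off: "triple_at g u = (False, False, False)" if u: "take n u \<noteq> ?z" for u
  proof -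
    have "\<not> swap g (u @ [x])" for x
    proof
      assume *: "swap g (u @ [x])"
      have "length u < n"
        using * u by (cases "length u < n") (auto simp: s)
      then have "drop n (u @ [x]) = []" by simp
      then show False using * k0 by (simp add: s)
    qed
    then show ?thesis using u by (simp add: triple_at_def s)
  qed
  have one: "(False, False, False) \<in> root_triples (avoiding F)"
  proof -
    have "id \<in> avoiding F"
      using subgroup.one_closed[OF G] by (simp add: AutT_def)
    moreover have "triple_at id [] = (False, False, False)"
      by (simp add: triple_at_def swap_def local_perm_def)
    ultimately show ?thesis by (metis image_eqI root_triples_def)
  qed
  have "g \<in> avoiding F"
  proof (rule avoiding_memberI[OF F g])
    fix u show "triple_at g u \<in> root_triples (avoiding F)"
      using below off one triple_at_avoiding[OF k(1)] by (cases "take n u = ?z") simp_all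
  qed
  moreover have "triple_at g ?z = (False, b, c)"
    using below[of ?z] k(2) by simp
  moreover have "triple_at g u = (False, False, False)" if "length u \<le> n" "u \<noteq> ?z" for u
    using off[of u] that by simp
  ultimately show ?thesis by blast
qed


section \<open>Level sums and topological generation\<close>

definition level_sum :: "(triple \<Rightarrow> int) \<Rightarrow> nat \<Rightarrow> (word \<Rightarrow> word) \<Rightarrow> int" where
  "level_sum \<phi> n g = (\<Sum>u | length u = n. \<phi> (triple_at g u))"

lemma level_sum_comp:
  assumes hom: "\<And>s t. s \<in> P \<Longrightarrow> t \<in> P \<Longrightarrow> [\<phi> (triple_mult s t) = \<phi> s + \<phi> t] (mod 4)"
    and f: "tree_automorphism f" "\<And>u. triple_at f u \<in> P"
    and g: "tree_automorphism g" "\<And>u. triple_at g u \<in> P"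
  shows "[level_sum \<phi> n (f \<circ> g) = level_sum \<phi> n f + level_sum \<phi> n g] (mod 4)"
proof -
  have "[level_sum \<phi> n (f \<circ> g)
      = (\<Sum>u | length u = n. \<phi> (triple_at f (g u)) + \<phi> (triple_at g u))] (mod 4)"
    unfolding level_sum_def by (rule cong_sum) (simp add: triple_at_comp f g hom)
  \<comment> \<open>\<open>g\<close> permutes level \<open>n\<close>, so the sum for
    \<open>f\<close> can be reindexed.\<close>
  also have "(\<Sum>u | length u = n. \<phi> (triple_at f (g u)) + \<phi> (triple_at g u))
      = level_sum \<phi> n f + level_sum \<phi> n g"
    using sum.reindex_bij_betw[OF bij_betw_level[OF g(1)], of "\<lambda>u. \<phi> (triple_at f u)" n]
    by (simp add: level_sum_def sum.distrib)
  finally show ?thesis .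
qed

text \<open>Modulo \<open>m\<close>, the values on a word in \<open>S\<close> are combinations of
  the values on \<open>S\<close>, with the exponent sums as coefficients. These do not depend on
  \<open>n\<close> and matter only modulo \<open>m\<close>, which leaves finitely many
  choices.\<close>

lemma finite_mod_values_generate:
  fixes \<Phi> :: "nat \<Rightarrow> 'a \<Rightarrow> int" and m :: int
  assumes "group A" "finite S" "S \<subseteq> carrier A" "m > 0"
    and hom: "\<And>n g h. g \<in> generate A S \<Longrightarrow> h \<in> generate A S \<Longrightarrow>
      [\<Phi> n (g \<otimes>\<^bsub>A\<^esub> h) = \<Phi> n g + \<Phi> n h] (mod m)"
  shows "finite ((\<lambda>g n. \<Phi> n g mod m) ` generate A S)"
proof -
  interpret group A by fact
  have \<Phi>_one: "[\<Phi> n \<one>\<^bsub>A\<^esub> = 0] (mod m)" for n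
    using hom[of "\<one>\<^bsub>A\<^esub>" "\<one>\<^bsub>A\<^esub>" n] generate.one[of A S]
    by (simp add: cong_iff_dvd_diff)
  have delta: "(\<Sum>s\<in>S. of_bool (s = h) * f s) = f h" if "h \<in> S" for h and f :: "'a \<Rightarrow> int"
  proof -
    have "(\<Sum>s\<in>S. of_bool (s = h) * f s) = (\<Sum>s\<in>S. if s = h then f s else 0)"
      by (rule sum.cong) auto
    then show ?thesis using that assms(2) by simp
  qed
  have ex: "\<exists>c. \<forall>n. [\<Phi> n g = (\<Sum>s\<in>S. c s * \<Phi> n s)] (mod m)" if "g \<in> generate A S" for g
    using that
  proof (induction g rule: generate.induct)
    case one
    show ?case
      by (rule exI[of _ "\<lambda>_. 0"]) (simp add: \<Phi>_one)
  next
    case (incl h)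
    show ?case
      by (rule exI[of _ "\<lambda>s. of_bool (s = h)"])
        (simp add: delta[OF incl])
  next
    case (inv h)
    have "[\<Phi> n (inv\<^bsub>A\<^esub> h) = - \<Phi> n h] (mod m)" for n
    proof -
      have "[\<Phi> n \<one>\<^bsub>A\<^esub> = \<Phi> n (inv\<^bsub>A\<^esub> h) + \<Phi> n h] (mod m)"
        using hom[OF generate.inv[OF inv] generate.incl[OF inv], of n] inv assms(3)
        by (simp add: subset_iff)
      with \<Phi>_one[of n] have "[0 = \<Phi> n (inv\<^bsub>A\<^esub> h) + \<Phi> n h] (mod m)"
        by (metis cong_sym cong_trans)
      from cong_diff[OF this cong_refl[of "\<Phi> n h"]] show ?thesis
        by (simp add: cong_sym_eq)
    qed
    then show ?case
      by (intro exI[of _ "\<lambda>s. - of_bool (s = h)"])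
        (simp add: sum_negf delta[OF inv])
  next
    case (eng g h)
    then obtain c d where "\<And>n. [\<Phi> n g = (\<Sum>s\<in>S. c s * \<Phi> n s)] (mod m)"
      "\<And>n. [\<Phi> n h = (\<Sum>s\<in>S. d s * \<Phi> n s)] (mod m)"
      by blast
    then have "[\<Phi> n (g \<otimes>\<^bsub>A\<^esub> h) = (\<Sum>s\<in>S. (c s + d s) * \<Phi> n s)] (mod m)" for n
      using cong_trans[OF hom[OF eng.hyps] cong_add]
      by (simp add: distrib_right sum.distrib)
    then show ?case
      by (intro exI[of _ "\<lambda>s. c s + d s"]) simp
  qed
  let ?v = "\<lambda>c n. (\<Sum>s\<in>S. c s * \<Phi> n s) mod m"
  have "(\<lambda>g n. \<Phi> n g mod m) ` generate A S \<subseteq> ?v ` (S \<rightarrow>\<^sub>E {0..<m})"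
  proof (rule image_subsetI)
    fix g assume "g \<in> generate A S"
    then obtain c where c: "\<And>n. [\<Phi> n g = (\<Sum>s\<in>S. c s * \<Phi> n s)] (mod m)"
      using ex by blast
    let ?c = "\<lambda>s\<in>S. c s mod m"
    have "[(\<Sum>s\<in>S. c s * \<Phi> n s) = (\<Sum>s\<in>S. ?c s * \<Phi> n s)] (mod m)" for n
      by (rule cong_sum) (simp add: cong_def mod_simps)
    then have "(\<lambda>n. \<Phi> n g mod m) = ?v ?c"
      using c by (metis (no_types, lifting) cong_def)
    moreover have "?c \<in> S \<rightarrow>\<^sub>E {0..<m}"
      using assms(4) by auto
    ultimately show "(\<lambda>n. \<Phi> n g mod m) \<in> ?v ` (S \<rightarrow>\<^sub>E {0..<m})"
      by blast
  qed
  moreover have "finite (S \<rightarrow>\<^sub>E {0..<m})"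
    using assms(2) by (simp add: finite_PiE)
  ultimately show ?thesis
    by (blast intro: finite_subset)
qed

lemma closure_generate_approx:
  assumes "g \<in> aut_topology closure_of H"
  shows "\<exists>h\<in>H. \<forall>u. length u \<le> n \<longrightarrow> local_perm g u = local_perm h u"
proof -
  interpret Metric_space "carrier AutT" aut_dist by (rule Metric_space_AutT)
  have "\<forall>r>0. \<exists>h\<in>H. h \<in> mball g r"
    using assms unfolding aut_topology_def metric_closure_of by blast
  \<comment> \<open>A difference at depth at most \<open>n\<close> forces distance at least
    \<open>(1/2) ^ n\<close>, so the open ball of this radius suffices.\<close>
  moreover have "(0 :: real) < (1/2) ^ n" by simp
  ultimately have "\<exists>h\<in>H. h \<in> mball g ((1/2) ^ n)" by blast
  then obtain h where h: "h \<in> H" "aut_dist g h < (1/2) ^ n" by auto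
  have "local_perm g u = local_perm h u" if "length u \<le> n" for u
  proof (rule ccontr)
    assume "local_perm g u \<noteq> local_perm h u"
    then have "(1/2) ^ length u \<le> aut_dist g h" by (rule aut_dist_ge)
    moreover have "(1/2 :: real) ^ n \<le> (1/2) ^ length u"
      using that by (intro power_decreasing) auto
    ultimately show False using h(2) by linarith
  qed
  then show ?thesis using h(1) by blast
qed

theorem theorem2:
  fixes F :: "pattern set"
  assumes "F \<subseteq> patterns 1 \<union> patterns 2"
    and "subgroup (avoiding F) AutT"
    and "infinite (avoiding F)"
  shows "\<not> topologically_finitely_generated (avoiding F)"
proof
  let ?G = "avoiding F" and ?P = "root_triples (avoiding F)"
  assume "topologically_finitely_generated ?G"
  then obtain S where S: "finite S" "S \<subseteq> carrier AutT"
    and cl: "?G = aut_topology closure_of (generate AutT S)"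
    by (auto simp: topologically_finitely_generated_def)
  interpret Metric_space "carrier AutT" aut_dist by (rule Metric_space_AutT)
  \<comment> \<open>This puts the patterns of the generated subgroup into \<open>?P\<close>, where
    \<open>\<phi>\<close> is a homomorphism.\<close>
  have HG: "generate AutT S \<subseteq> ?G"
    unfolding cl using group.generate_incl[OF group_AutT S(2)]
    by (intro closure_of_subset) (simp add: aut_topology_def)
  obtain \<phi> :: "triple \<Rightarrow> int" and b c where \<phi>0: "\<phi> (False, False, False) = 0"
    and \<phi>_hom: "\<And>s t. s \<in> ?P \<Longrightarrow> t \<in> ?P \<Longrightarrow> [\<phi> (triple_mult s t) = \<phi> s + \<phi> t] (mod 4)"
    and bc: "(False, b, c) \<in> ?P" "\<not> [\<phi> (False, b, c) = 0] (mod 4)"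
    using triple_character[OF root_triples_mult[OF assms(2)]]
      infinite_avoiding_triples[OF assms(2,3)] by metis
  let ?v = "\<lambda>g n. level_sum \<phi> n g mod 4"
  have fin: "finite (?v ` generate AutT S)"
  proof (rule finite_mod_values_generate[OF group_AutT S])
    fix n g h assume "g \<in> generate AutT S" "h \<in> generate AutT S"
    then have "g \<in> ?G" "h \<in> ?G" using HG by auto
    then have "[level_sum \<phi> n (g \<circ> h) = level_sum \<phi> n g + level_sum \<phi> n h] (mod 4)"
      by (intro level_sum_comp[where P = ?P] \<phi>_hom triple_at_avoiding)
        (auto intro: avoiding_automorphism)
    then show "[level_sum \<phi> n (g \<otimes>\<^bsub>AutT\<^esub> h) = level_sum \<phi> n g + level_sum \<phi> n h] (mod 4)"
      by (simp add: AutT_def)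
  qed simp
  have "\<exists>h\<in>generate AutT S. (\<forall>m<n. ?v h m = 0) \<and> ?v h n \<noteq> 0" for n
  proof -
    let ?z = "replicate n False"
    obtain g where g: "g \<in> ?G" "triple_at g ?z = (False, b, c)"
      "\<And>u. length u \<le> n \<Longrightarrow> u \<noteq> ?z \<Longrightarrow> triple_at g u = (False, False, False)"
      using avoiding_deep_element[OF assms(1,2) bc(1), of n] by blast
    \<comment> \<open>Agreement down to level \<open>Suc n\<close> is required because triples at
      level \<open>n\<close> include the labels of the children.\<close>
    obtain h where h: "h \<in> generate AutT S"
      and "\<And>u. length u \<le> Suc n \<Longrightarrow> local_perm g u = local_perm h u"
      using closure_generate_approx[of g "generate AutT S" "Suc n"] g(1) cl by blast
    then have "triple_at h u = triple_at g u" if "length u \<le> n" for u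
      using that by (simp add: triple_at_def swap_def)
    then have eq: "level_sum \<phi> m h = level_sum \<phi> m g" if "m \<le> n" for m
      using that by (simp add: level_sum_def)
    have "level_sum \<phi> m g = 0" if "m < n" for m
    proof -
      have "triple_at g u = (False, False, False)" if "length u = m" for u
      proof (rule g(3))
        show "u \<noteq> ?z" using \<open>length u = m\<close> \<open>m < n\<close> by auto
      qed (use \<open>length u = m\<close> \<open>m < n\<close> in simp)
      then show ?thesis by (simp add: level_sum_def \<phi>0)
    qed
    moreover have "level_sum \<phi> n g = \<phi> (False, b, c)"
    proof -
      have "level_sum \<phi> n g = (\<Sum>u | length u = n. if u = ?z then \<phi> (False, b, c) else 0)"
        unfolding level_sum_def by (rule sum.cong) (simp_all add: g(2,3) \<phi>0)
      then show ?thesis by (simp add: finite_level)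
    qed
    ultimately show ?thesis
      using h eq bc(2) by (intro bexI[of _ h]) (auto simp: cong_def)
  qed
  then obtain h where h: "\<And>n. h n \<in> generate AutT S" "\<And>m n. m < n \<Longrightarrow> ?v (h n) m = 0"
    "\<And>n. ?v (h n) n \<noteq> 0"
    by metis
  \<comment> \<open>For \<open>m < n\<close>, index \<open>m\<close> separates the two sequences:
    the value is nonzero for \<open>h m\<close> and zero for \<open>h n\<close>.\<close>
  have "inj (\<lambda>n. ?v (h n))"
  proof (rule linorder_injI)
    fix m n :: nat assume "m < n"
    then show "?v (h m) \<noteq> ?v (h n)" using h(2,3) by metis
  qed
  moreover have "range (\<lambda>n. ?v (h n)) \<subseteq> ?v ` generate AutT S"
    using h(1) by auto
  ultimately show False
    using fin finite_subset range_inj_infinite by blast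
qed

end
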